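(* Let $n$ be even, let $j_1<j_2<\cdots<j_k$ be positive integers less than $n/2$, and let $J(n)=\{j_1,\ldots,j_k,n/2\}$, with $\mathrm{Ci}_n(J(n))$ connected. Then \[\operatorname{gon}(\mathrm{Ci}_n(J(n)))\le 4\sum_{\alpha=1}^k j_\alpha^2.\]
   Context: For $J\subset\{1,\ldots,\lfloor n/2\rfloor\}$, the circulant graph $\mathrm{Ci}_n(J)$ has vertices $v_1,\ldots,v_n$ with $v_i$ adjacent to $v_m$ iff $|i-m|\bmod n\in J$. For a connected loopless multigraph $G$: a divisor is a function $D:V(G)\to\mathbb{Z}$; effective if all values are $\ge0$; degree $\sum_vD(v)$. Firing a vertex $v$ moves one chip from $v$ along each incident edge; divisors are equivalent if related by a sequence of firings. $D$ has positive rank if for every vertex $q$, $D-q$ is equivalent to an effective divisor. $\operatorname{gon}(G)$ is the minimum degree of a positive rank divisor. *)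

theory Defs
  imports "Graph_Theory.Graph_Theory"
begin

text \<open>
  An undirected multigraph is represented as a digraph in which every edge $uv$ contributes
  one arc from $u$ to $v$ and one arc from $v$ to $u$, paired by an arc-reversing involution.
  Hence the arcs in \<^term>\<open>out_arcs G v\<close> correspond one-to-one to the edges incident with $v$.
\<close>

definition loopless_multigraph :: "('a, 'b) pre_digraph \<Rightarrow> bool" where
  "loopless_multigraph G \<longleftrightarrow>
     fin_digraph G \<and> loopfree_digraph G \<and> (\<exists>arev. bidirected_digraph G arev)"

text \<open>
  Divisors are integer-valued functions on the vertex type; only their values on
  \<^term>\<open>verts G\<close> matter, and firing leaves all other values unchanged.
\<close>

definition div_degree :: "('a, 'b) pre_digraph \<Rightarrow> ('a \<Rightarrow> int) \<Rightarrow> int" where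
  "div_degree G D = (\<Sum>v\<in>verts G. D v)"

definition div_effective :: "('a, 'b) pre_digraph \<Rightarrow> ('a \<Rightarrow> int) \<Rightarrow> bool" where
  "div_effective G D \<longleftrightarrow> (\<forall>v\<in>verts G. 0 \<le> D v)"

definition fire :: "('a, 'b) pre_digraph \<Rightarrow> 'a \<Rightarrow> ('a \<Rightarrow> int) \<Rightarrow> 'a \<Rightarrow> int" where
  "fire G v D = (\<lambda>u. D u + int (card {e \<in> out_arcs G v. head G e = u})
                        - (if u = v then int (out_degree G v) else 0))"

definition firing_step :: "('a, 'b) pre_digraph \<Rightarrow> ('a \<Rightarrow> int) \<Rightarrow> ('a \<Rightarrow> int) \<Rightarrow> bool" where
  "firing_step G D D' \<longleftrightarrow> (\<exists>v\<in>verts G. D' = fire G v D)"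

text \<open>
  On a multigraph this is symmetric: firing every vertex once changes nothing, so firing
  $v$ is undone by firing all the other vertices.
\<close>

definition div_equiv :: "('a, 'b) pre_digraph \<Rightarrow> ('a \<Rightarrow> int) \<Rightarrow> ('a \<Rightarrow> int) \<Rightarrow> bool" where
  "div_equiv G = (firing_step G)\<^sup>*\<^sup>*"

definition positive_rank :: "('a, 'b) pre_digraph \<Rightarrow> ('a \<Rightarrow> int) \<Rightarrow> bool" where
  "positive_rank G D \<longleftrightarrow>
     (\<forall>q\<in>verts G. \<exists>E. div_equiv G (D(q := D q - 1)) E \<and> div_effective G E)"

text \<open>
  Firing preserves the degree, so a divisor of positive rank has degree at least $1$ as soon as
  there is a vertex; taking the minimum over natural numbers therefore loses nothing.
  The minimum exists because the all-ones divisor has positive rank.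
\<close>

definition gonality :: "('a, 'b) pre_digraph \<Rightarrow> nat" where
  "gonality G = (LEAST d. \<exists>D. positive_rank G D \<and> div_degree G D = int d)"

lemma gonality_attained:
  assumes "finite (verts G)"
  shows "\<exists>D. positive_rank G D \<and> div_degree G D = int (gonality G)"
proof -
  have "positive_rank G (\<lambda>_. 1)"
    unfolding positive_rank_def
  proof
    fix q assume "q \<in> verts G"
    let ?E = "(\<lambda>_. 1 :: int)(q := 1 - 1)"
    have "div_equiv G ?E ?E"
      by (simp add: div_equiv_def)
    moreover have "div_effective G ?E"
      by (simp add: div_effective_def)
    ultimately show "\<exists>E. div_equiv G ?E E \<and> div_effective G E"
      by blast
  qed
  moreover have "div_degree G (\<lambda>_. 1) = int (card (verts G))"
    by (simp add: div_degree_def)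
  ultimately have "\<exists>d D. positive_rank G D \<and> div_degree G D = int d"
    by blast
  then show ?thesis
    unfolding gonality_def by (rule LeastI_ex)
qed

text \<open>
  The condition ``$|i-m| \bmod n \in J$'' is understood in the integers modulo $n$, where the sign
  of $i-m$ is disregarded after reduction: for example $v_1$ and $v_n$ are adjacent iff $1 \in J$.
\<close>

definition circulant_graph :: "nat \<Rightarrow> nat set \<Rightarrow> (nat, nat \<times> nat) pre_digraph" where
  "circulant_graph n J =
     \<lparr>verts = {1..n},
      arcs = {(i, m). i \<in> {1..n} \<and> m \<in> {1..n} \<and>
                ((int i - int m) mod int n \<in> int ` J \<or> (int m - int i) mod int n \<in> int ` J)},
      tail = fst, head = snd\<rparr>"

lemma loopless_multigraph_circulant_graph:
  assumes "J \<subseteq> {1..n div 2}"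
  shows "loopless_multigraph (circulant_graph n J)"
proof -
  define G where "G = circulant_graph n J"
  define r where "r = (\<lambda>e. if e \<in> arcs G then prod.swap e else e)"
  have arcs_iff: "(i, m) \<in> arcs G \<longleftrightarrow> i \<in> {1..n} \<and> m \<in> {1..n} \<and>
      ((int i - int m) mod int n \<in> int ` J \<or> (int m - int i) mod int n \<in> int ` J)" for i m
    by (simp only: G_def circulant_graph_def pre_digraph.simps mem_Collect_eq prod.case)
  have ends: "verts G = {1..n}" "tail G = fst" "head G = snd"
    by (simp_all add: G_def circulant_graph_def)
  have sub: "arcs G \<subseteq> {1..n} \<times> {1..n}"
    by (rule subrelI) (simp add: arcs_iff)
  have fin: "finite (arcs G)"
    by (rule finite_subset[OF sub]) simp
  have "0 \<notin> int ` J"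
    using assms by force
  then have nl: "fst e \<noteq> snd e" if "e \<in> arcs G" for e
    using that arcs_iff[of "fst e" "snd e"] by (metis diff_self mod_0 prod.collapse)
  have sw: "prod.swap e \<in> arcs G" if "e \<in> arcs G" for e
    using that arcs_iff[of "fst e" "snd e"] arcs_iff[of "snd e" "fst e"]
    by (metis prod.collapse swap_simp)
  have wf: "wf_digraph G"
    by (rule wf_digraph.intro) (use sub ends in force)+
  have "fin_digraph G"
    by (rule fin_digraph.intro[OF wf], rule fin_digraph_axioms.intro) (simp_all add: ends fin)
  moreover have "loopfree_digraph G"
    by (rule loopfree_digraph.intro[OF wf], rule loopfree_digraph_axioms.intro)
      (simp add: ends nl)
  moreover have "bidirected_digraph G r"
  proof (rule wf_digraph.bidirected_digraphI[OF wf])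
    show "r e = e" if "e \<notin> arcs G" for e
      using that by (simp add: r_def)
    fix e assume e: "e \<in> arcs G"
    then have re: "r e = prod.swap e" by (simp add: r_def)
    show "r e \<noteq> e"
      unfolding re using nl[OF e] by (metis fst_swap)
    show "r (r e) = e"
      unfolding re using sw[OF e] by (simp add: r_def)
    show "tail G (r e) = head G e"
      by (simp add: re ends)
  qed
  ultimately show ?thesis
    unfolding loopless_multigraph_def G_def by blast
qed

end

theory Submission
  imports Defs
begin

text \<open>
  Put $h = n/2$. The second difference of the pyramid of height $a$ is the Laplacian of the
  jump $a$, so firing the vertices $c', \ldots, c$ of an arc moves the summit of one pyramid from
  $c$ to $c+1$ and that of another one from $c'$ to $c'-1$. The divisor
  $D_t$ consisting of pyramids of height $j_\alpha$ and volume $j_\alpha^2$ around the four vertices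
  $\pm t$, $\pm t + h$ becomes $D_{t+1}$ when all vertices in $\{-t,\ldots,t\}$ and their antipodes
  are fired; as the fired vertices come in antipodal pairs, the edges of jump $h$ cancel. Since
  $D_q$ has a chip on $q$, the divisor $D_0$ has positive rank.
\<close>

section \<open>Pyramids on the integers: second differences and volume\<close>

text \<open>Layer \<open>i\<close> is the window of radius \<open>i\<close>, so
  \<open>f (c + d)\<close> is counted max(0, a - |d|) times. With \<open>chip n v\<close> for
  \<open>f\<close>, this is the number of chips that a pyramid on the integers, wrapped around the
  cycle, puts on \<open>v\<close>; overlaps need no special treatment.\<close>

definition pyramid :: "(int \<Rightarrow> int) \<Rightarrow> nat \<Rightarrow> int \<Rightarrow> int" where
  "pyramid f a c = (\<Sum>i<a. \<Sum>d\<in>{- int i..int i}. f (c + d))"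

lemma sum_int_interval_shift:
  fixes f :: "int \<Rightarrow> int"
  shows "(\<Sum>d\<in>{- int i..int i}. f (c + 1 + d)) - (\<Sum>d\<in>{- int i..int i}. f (c + d))
    = f (c + int i + 1) - f (c - int i)"
proof (induction i)
  case 0
  then show ?case by simp
next
  case (Suc i)
  have "{- int (Suc i)..int (Suc i)} = insert (- int i - 1) (insert (int i + 1) {- int i..int i})"
    by auto
  then show ?case
    using Suc by (simp add: algebra_simps)
qed

text \<open>A unit shift changes a window only at its ends; by induction on \<open>a\<close>, each
  new layer moves the two outer terms from distance \<open>a\<close> to
  \<open>a + 1\<close>.\<close>

lemma pyramid_second_difference:
  "pyramid f a (c + 1) - 2 * pyramid f a c + pyramid f a (c - 1)
    = f (c + int a) + f (c - int a) - 2 * f c"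
proof (induction a)
  case 0
  then show ?case by (simp add: pyramid_def)
next
  case (Suc a)
  then show ?case
    using sum_int_interval_shift[of f c a] sum_int_interval_shift[of f "c - 1" a]
    by (simp add: pyramid_def algebra_simps)
qed

text \<open>Telescoping: only the outward differences at the two ends survive.\<close>

lemma sum_second_difference:
  fixes g :: "int \<Rightarrow> int"
  shows "(\<Sum>i\<in>{- int t..int t}. g (i + 1) - 2 * g i + g (i - 1))
    = g (int t + 1) + g (- int t - 1) - g (int t) - g (- int t)"
proof (induction t)
  case 0
  then show ?case by simp
next
  case (Suc t)
  have "{- int (Suc t)..int (Suc t)} = insert (- 1 - int t) (insert (1 + int t) {- int t..int t})"
    by auto
  then show ?case
    using Suc by (simp add: algebra_simps minus_diff_commute)
qed

text \<open>\<open>s\<close> is the centre of the fired arc, later \<open>0\<close> for the arc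
  itself and \<open>h\<close> for its antipodal copy.\<close>

lemma sum_pyramid_laplacian:
  "(\<Sum>i\<in>{- int t..int t}. f (i + s + int a) + f (i + s - int a) - 2 * f (i + s))
    = pyramid f a (int t + 1 + s) + pyramid f a (- int t - 1 + s)
      - pyramid f a (int t + s) - pyramid f a (- int t + s)"
proof -
  have "pyramid f a (i + 1 + s) - 2 * pyramid f a (i + s) + pyramid f a (i - 1 + s)
      = f (i + s + int a) + f (i + s - int a) - 2 * f (i + s)" for i
    using pyramid_second_difference[of f a "i + s"] by (simp add: algebra_simps)
  then show ?thesis
    using sum_second_difference[of "\<lambda>i. pyramid f a (i + s)" t] by simp
qed

lemma pyramid_nonneg:
  assumes "\<And>x. 0 \<le> f x"
  shows "0 \<le> pyramid f a c"
  unfolding pyramid_def by (intro sum_nonneg assms)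

lemma pyramid_ge_summit:
  assumes "\<And>x. 0 \<le> f x" and "0 < a"
  shows "f c \<le> pyramid f a c"
proof -
  \<comment> \<open>Only the layer of radius 0, the single term \<open>f c\<close>, is kept.\<close>
  have "(\<Sum>i\<in>{0}. \<Sum>d\<in>{- int i..int i}. f (c + d)) \<le> pyramid f a c"
    unfolding pyramid_def using assms by (intro sum_mono2) (auto intro: sum_nonneg)
  then show ?thesis by simp
qed

text \<open>Every position has total weight 1 over \<open>V\<close>, so layer \<open>i\<close>
  weighs \<open>2 * i + 1\<close>, and the first \<open>a\<close> odd numbers add up to a
  square.\<close>

lemma pyramid_volume:
  assumes "\<And>y. (\<Sum>v\<in>V. f v y) = 1"
  shows "(\<Sum>v\<in>V. pyramid (f v) a c) = (int a)\<^sup>2"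
proof -
  have "(\<Sum>v\<in>V. pyramid (f v) a c) = (\<Sum>i<a. \<Sum>d\<in>{- int i..int i}. \<Sum>v\<in>V. f v (c + d))"
    unfolding pyramid_def by (subst sum.swap) (intro sum.cong refl, rule sum.swap)
  also have "\<dots> = (\<Sum>i<a. 2 * int i + 1)"
    by (simp add: assms)
  also have "\<dots> = (int a)\<^sup>2"
    by (induction a) (simp_all add: power2_eq_square algebra_simps)
  finally show ?thesis .
qed

section \<open>Firing families of vertices\<close>

lemma fire_eq_add: "fire G v D = (\<lambda>u. D u + fire G v (\<lambda>_. 0) u)"
  by (simp add: fire_def fun_eq_iff)

text \<open>\<open>r\<close> need not be injective: an arc longer than the cycle wraps around and
  fires some vertices several times.\<close>

lemma div_equiv_fire_family:
  assumes "finite I" and "\<And>i. i \<in> I \<Longrightarrow> r i \<in> verts G"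
  shows "div_equiv G D (\<lambda>u. D u + (\<Sum>i\<in>I. fire G (r i) (\<lambda>_. 0) u))"
  using assms
proof (induction I)
  case empty
  then show ?case by (simp add: div_equiv_def)
next
  case (insert i I)
  let ?E = "\<lambda>u. D u + (\<Sum>i\<in>I. fire G (r i) (\<lambda>_. 0) u)"
  have "firing_step G ?E (fire G (r i) ?E)"
    using insert.prems by (auto simp: firing_step_def)
  moreover have "fire G (r i) ?E = (\<lambda>u. D u + (\<Sum>i\<in>insert i I. fire G (r i) (\<lambda>_. 0) u))"
    using insert.hyps by (subst fire_eq_add) (simp add: fun_eq_iff)
  ultimately show ?case
    using insert by (auto simp: div_equiv_def intro: rtranclp.rtrancl_into_rtrancl)
qed

lemma div_equiv_trans [trans]: "div_equiv G D E \<Longrightarrow> div_equiv G E F \<Longrightarrow> div_equiv G D F"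
  by (simp add: div_equiv_def)

section \<open>Residue classes and vertices\<close>

text \<open>
  The vertices of the circulant graph are $1, \ldots, n$, so \<open>chip n v y\<close> tells whether $v$ is the
  vertex of the residue class of $y$, and \<open>vertex_of n y\<close> is that vertex.
\<close>

definition chip :: "nat \<Rightarrow> nat \<Rightarrow> int \<Rightarrow> int" where
  "chip n v y = of_bool (v \<in> {1..n} \<and> int n dvd int v - y)"

definition vertex_of :: "nat \<Rightarrow> int \<Rightarrow> nat" where
  "vertex_of n y = nat ((y - 1) mod int n) + 1"

lemma vertex_of_in:
  assumes "0 < n"
  shows "vertex_of n y \<in> {1..n}"
proof -
  have "nat ((y - 1) mod int n) < n"
    using assms by (simp add: nat_less_iff)
  then show ?thesis by (simp add: vertex_of_def)
qed

lemma dvd_vertex_of: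
  assumes "0 < n"
  shows "int n dvd int (vertex_of n y) - y"
proof -
  have "int (vertex_of n y) - y = (y - 1) mod int n - (y - 1)"
    using assms by (simp add: vertex_of_def)
  then show ?thesis
    by (metis mod_eq_dvd_iff mod_mod_trivial)
qed

text \<open>The divisibility form of \<open>chip\<close> suits shifts of \<open>y\<close>; this form
  makes sums over vertices collapse to one term.\<close>

lemma chip_eq_vertex_of:
  assumes "0 < n"
  shows "chip n v y = of_bool (v = vertex_of n y)"
proof -
  have "v = vertex_of n y" if "v \<in> {1..n}" "int n dvd int v - y"
  proof -
    have "int n dvd int v - int (vertex_of n y)"
      using dvd_diff[OF that(2) dvd_vertex_of[OF assms, of y]] by simp
    \<comment> \<open>Lowering both by one puts them between 0 and n - 1, where reduction modulo
      \<open>n\<close> is the identity.\<close>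
    then have "int n dvd (int v - 1) - (int (vertex_of n y) - 1)"
      by simp
    then have "(int v - 1) mod int n = (int (vertex_of n y) - 1) mod int n"
      by (simp only: mod_eq_dvd_iff)
    then show ?thesis
      using that(1) vertex_of_in[OF assms, of y] by (simp add: mod_pos_pos_trivial)
  qed
  then have "v \<in> {1..n} \<and> int n dvd int v - y \<longleftrightarrow> v = vertex_of n y"
    using vertex_of_in[OF assms] dvd_vertex_of[OF assms] by blast
  then show ?thesis by (simp only: chip_def)
qed

lemma sum_chip: "0 < n \<Longrightarrow> (\<Sum>v\<in>{1..n}. chip n v y) = 1"
  using vertex_of_in[of n y] by (simp add: chip_eq_vertex_of of_bool_def)

lemma chip_nonneg: "0 \<le> chip n v y"
  by (simp add: chip_def)

lemma chip_cong:
  assumes "int n dvd x - y"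
  shows "chip n v x = chip n v y"
proof -
  have "int n dvd int v - x \<longleftrightarrow> int n dvd int v - y"
    using dvd_add_right_iff[OF assms, of "int v - x"] by simp
  then show ?thesis by (simp add: chip_def)
qed

text \<open>Elements of \<open>A\<close> are their own residues, so at most one term is
  nonzero.\<close>

lemma sum_of_bool_dvd_diff:
  assumes "A \<subseteq> {..<n}"
  shows "(\<Sum>a\<in>A. of_bool (int n dvd z - int a)) = (of_bool (z mod int n \<in> int ` A) :: int)"
proof -
  have fin: "finite A" using assms finite_subset by blast
  have "int n dvd z - int a \<longleftrightarrow> z mod int n = int a" if "a \<in> A" for a
    using that assms by (auto simp flip: mod_eq_dvd_iff)
  then have "(\<Sum>a\<in>A. of_bool (int n dvd z - int a))
      = (\<Sum>a\<in>A. of_bool (z mod int n = int a) :: int)"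
    by (intro sum.cong) auto
  also have "\<dots> = (\<Sum>b\<in>int ` A. of_bool (z mod int n = b))"
    by (simp add: sum.reindex)
  also have "\<dots> = of_bool (z mod int n \<in> int ` A)"
    using fin by (simp add: of_bool_def)
  finally show ?thesis .
qed

section \<open>Firing in the circulant graph\<close>

text \<open>Jumps below \<open>h\<close> contribute in both directions, while the jump
  \<open>h\<close> is its own negative modulo \<open>2 * h\<close> and counts once.\<close>

lemma card_out_arcs_circulant:
  assumes "A \<subseteq> {0<..<h}" and v: "v \<in> {1..2 * h}"
  shows "int (card {e \<in> out_arcs (circulant_graph (2 * h) (insert h A)) v.
            head (circulant_graph (2 * h) (insert h A)) e = u})
    = (\<Sum>a\<in>A. chip (2 * h) u (int v + int a) + chip (2 * h) u (int v - int a))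
      + chip (2 * h) u (int v + int h)"
    (is "int (card ?S) = _")
proof -
  define z where "z = int u - int v"
  let ?n = "2 * int h"
  have z': "(int v - int u) = - z" by (simp add: z_def)
  have h: "0 < h" using v by simp
  \<comment> \<open>Arcs are pairs of vertices, so at most one arc leads from \<open>v\<close> to
    \<open>u\<close>.\<close>
  have S: "?S = (if u \<in> {1..2 * h} \<and> (z mod ?n \<in> int ` insert h A \<or> (- z) mod ?n \<in> int ` insert h A)
      then {(v, u)} else {})"
    using v by (auto simp: circulant_graph_def out_arcs_def z_def)
  show ?thesis
  proof (cases "u \<in> {1..2 * h}")
    case False
    then show ?thesis unfolding S chip_def by auto
  next
    case True
    have plus: "(\<Sum>a\<in>A. chip (2 * h) u (int v + int a)) = of_bool (z mod ?n \<in> int ` A)"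
      using True assms sum_of_bool_dvd_diff[of A "2 * h" z]
      by (force simp: chip_def z_def algebra_simps)
    have "?n dvd int u - (int v - int a) \<longleftrightarrow> ?n dvd - z - int a" for a
      using dvd_minus_iff[of ?n "- z - int a"] by (simp add: z_def algebra_simps)
    then have minus: "(\<Sum>a\<in>A. chip (2 * h) u (int v - int a)) = of_bool ((- z) mod ?n \<in> int ` A)"
      using True assms sum_of_bool_dvd_diff[of A "2 * h" "- z"]
      by (force simp: chip_def)
    have mid: "chip (2 * h) u (int v + int h) = of_bool (z mod ?n = int h)"
      using True h mod_eq_dvd_iff[of z ?n "int h"]
      by (simp add: chip_def z_def algebra_simps)
    have neg: "(- z) mod ?n = (if z mod ?n = 0 then 0 else ?n - z mod ?n)"
      by (rule zmod_zminus1_eq_if)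
    have bounds: "x \<in> int ` A \<Longrightarrow> 0 < x \<and> x < int h" for x
      using assms by auto
    \<comment> \<open>The three conditions exclude each other: residues in \<open>A\<close> lie
      strictly between 0 and \<open>h\<close>, and their negatives strictly between \<open>h\<close>
      and \<open>2 * h\<close>.\<close>
    have "int (card ?S) = of_bool (z mod ?n \<in> int ` A) + of_bool ((- z) mod ?n \<in> int ` A)
        + of_bool (z mod ?n = int h)"
      unfolding S using True bounds[of "z mod ?n"] bounds[of "(- z) mod ?n"] h
      by (auto simp: neg split: if_splits)
    then show ?thesis
      by (simp add: sum.distrib plus minus mid)
  qed
qed

text \<open>The degree \<open>2 * card A + 1\<close> is split among the jumps, so that each jump
  contributes its own Laplacian.\<close>

lemma fire_circulant:
  assumes A: "A \<subseteq> {0<..<h}" and h: "0 < h"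
  shows "fire (circulant_graph (2 * h) (insert h A)) (vertex_of (2 * h) y) (\<lambda>_. 0) u
    = (\<Sum>a\<in>A. chip (2 * h) u (y + int a) + chip (2 * h) u (y - int a) - 2 * chip (2 * h) u y)
      + chip (2 * h) u (y + int h) - chip (2 * h) u y"
proof -
  let ?G = "circulant_graph (2 * h) (insert h A)"
  let ?n = "2 * h"
  let ?v = "vertex_of ?n y"
  have n: "0 < ?n" using h by simp
  have v: "?v \<in> {1..?n}" by (rule vertex_of_in[OF n])
  have shift: "chip ?n w (int ?v + d) = chip ?n w (y + d)" for w d
    using dvd_vertex_of[OF n, of y] by (intro chip_cong) simp
  have heads: "int (card {e \<in> out_arcs ?G ?v. head ?G e = w})
      = (\<Sum>a\<in>A. chip ?n w (y + int a) + chip ?n w (y - int a)) + chip ?n w (y + int h)" for w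
    using card_out_arcs_circulant[OF A v, of w] shift[of w] shift[of w "- int _"] by simp
  have "finite (arcs ?G)"
    by (rule finite_subset[of _ "{1..?n} \<times> {1..?n}"]) (auto simp: circulant_graph_def)
  then have fin: "finite (out_arcs ?G ?v)"
    by (simp add: out_arcs_def)
  have heads_in: "head ?G ` out_arcs ?G ?v \<subseteq> {1..?n}"
    by (auto simp: circulant_graph_def out_arcs_def)
  \<comment> \<open>The degree is found by sorting the outgoing arcs by head; each chip is then
    counted once over all vertices.\<close>
  have "out_degree ?G ?v = (\<Sum>w\<in>{1..?n}. card {e \<in> out_arcs ?G ?v. head ?G e = w})"
    unfolding out_degree_def card_eq_sum
    by (rule sum.group[OF fin finite_atLeastAtMost heads_in, symmetric])
  then have "int (out_degree ?G ?v)
      = (\<Sum>w\<in>{1..?n}. (\<Sum>a\<in>A. chip ?n w (y + int a) + chip ?n w (y - int a))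
          + chip ?n w (y + int h))"
    by (simp only: of_nat_sum heads)
  also have "\<dots> = 2 * int (card A) + 1"
    by (simp only: sum.distrib sum.swap[of _ A] sum_chip[OF n]) simp
  finally have deg: "int (out_degree ?G ?v) = 2 * int (card A) + 1" .
  show ?thesis
    unfolding fire_def heads deg
    by (simp add: chip_eq_vertex_of[OF n, of u y] sum_subtractf sum.distrib)
qed

section \<open>The divisor of four pyramids: equivalence, rank and degree\<close>

text \<open>Coinciding summits add up: at \<open>t = 0\<close> there are two doubled pyramids for
  each jump, and \<open>t\<close> may exceed the length of the cycle.\<close>

definition four_pyramids :: "nat \<Rightarrow> nat set \<Rightarrow> int \<Rightarrow> nat \<Rightarrow> int" where
  "four_pyramids h A t v = (\<Sum>a\<in>A. \<Sum>c\<in>{0, int h}.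
     pyramid (chip (2 * h) v) a (t + c) + pyramid (chip (2 * h) v) a (- t + c))"

text \<open>The arbitrary summand \<open>F\<close> is carried along so that the chip removed at a
  vertex can be included.\<close>

lemma div_equiv_four_pyramids:
  assumes A: "A \<subseteq> {0<..<h}" and h: "0 < h"
  shows "div_equiv (circulant_graph (2 * h) (insert h A))
    (\<lambda>u. four_pyramids h A 0 u + F u) (\<lambda>u. four_pyramids h A (int t) u + F u)"
proof (induction t)
  case 0
  then show ?case by (simp add: div_equiv_def)
next
  case (Suc t)
  let ?G = "circulant_graph (2 * h) (insert h A)"
  let ?n = "2 * h"
  let ?I = "{- int t..int t}"
  let ?D = "\<lambda>u. four_pyramids h A (int t) u + F u"
  define L where "L c u = (\<Sum>i\<in>?I. fire ?G (vertex_of ?n (i + c)) (\<lambda>_. 0) u)" for c u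
  have vert: "vertex_of ?n y \<in> verts ?G" for y
    using vertex_of_in[of ?n y] h by (simp add: circulant_graph_def)
  note Suc.IH
  \<comment> \<open>First the arc around 0 is fired, then its antipodal copy around
    \<open>h\<close>.\<close>
  also have "div_equiv ?G ?D (\<lambda>u. ?D u + L 0 u)"
    unfolding L_def by (rule div_equiv_fire_family) (simp_all only: vert finite_atLeastAtMost_int)
  also have "div_equiv ?G (\<lambda>u. ?D u + L 0 u) (\<lambda>u. ?D u + L 0 u + L (int h) u)"
    unfolding L_def by (rule div_equiv_fire_family) (simp_all only: vert finite_atLeastAtMost_int)
  also have "(\<lambda>u. ?D u + L 0 u + L (int h) u) = (\<lambda>u. four_pyramids h A (int (Suc t)) u + F u)"
  proof
    fix u
    let ?X = "\<lambda>c. \<Sum>i\<in>?I. \<Sum>a\<in>A. chip ?n u (i + c + int a) + chip ?n u (i + c - int a)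
        - 2 * chip ?n u (i + c)"
    \<comment> \<open>Summing over the arc first turns the Laplacian of each jump into pyramid moves
      at the two ends.\<close>
    have X: "?X c = (\<Sum>a\<in>A. pyramid (chip ?n u) a (int t + 1 + c)
        + pyramid (chip ?n u) a (- int t - 1 + c)
        - pyramid (chip ?n u) a (int t + c) - pyramid (chip ?n u) a (- int t + c))" for c
      by (subst sum.swap) (simp only: sum_pyramid_laplacian)
    have L: "L c u = ?X c + (\<Sum>i\<in>?I. chip ?n u (i + c + int h) - chip ?n u (i + c))" for c
      by (simp only: L_def fire_circulant[OF A h] sum.distrib diff_conv_add_uminus add.assoc)
    \<comment> \<open>Two jumps by \<open>h\<close> close up, so the jump-\<open>h\<close> terms of
      the two arcs are opposite and cancel.\<close>
    have antipode: "chip ?n u (i + int h + int h) = chip ?n u i" for i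
      by (rule chip_cong) simp
    have "L 0 u + L (int h) u = ?X 0 + ?X (int h)"
      unfolding L antipode by (simp add: sum_subtractf)
    then show "?D u + L 0 u + L (int h) u = four_pyramids h A (int (Suc t)) u + F u"
      unfolding X four_pyramids_def using h
      by (simp add: sum.distrib sum_subtractf algebra_simps minus_diff_commute)
  qed
  finally show ?case .
qed

lemma positive_rank_four_pyramids:
  assumes A: "A \<subseteq> {0<..<h}" "A \<noteq> {}"
  shows "positive_rank (circulant_graph (2 * h) (insert h A)) (four_pyramids h A 0)"
  unfolding positive_rank_def
proof
  let ?G = "circulant_graph (2 * h) (insert h A)"
  fix q assume "q \<in> verts ?G"
  then have q: "q \<in> {1..2 * h}" by (simp add: circulant_graph_def)
  have h: "0 < h" and fin: "finite A"
    using A finite_subset by auto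
  define F where "F u = (if u = q then - 1 else 0 :: int)" for u
  \<comment> \<open>For \<open>t = q\<close> a summit lies on \<open>q\<close> and supplies the chip
    that \<open>F\<close> takes away.\<close>
  let ?E = "\<lambda>u. four_pyramids h A (int q) u + F u"
  have start: "(four_pyramids h A 0)(q := four_pyramids h A 0 q - 1)
      = (\<lambda>u. four_pyramids h A 0 u + F u)"
    by (auto simp: F_def)
  have pyr: "0 \<le> pyramid (chip (2 * h) u) a c" for u a c
    by (rule pyramid_nonneg) (rule chip_nonneg)
  obtain a where a: "a \<in> A" "0 < a" using A by force
  have "1 = chip (2 * h) q (int q)"
    using q by (simp add: chip_def)
  also have "\<dots> \<le> pyramid (chip (2 * h) q) a (int q)"
    by (rule pyramid_ge_summit[OF chip_nonneg a(2)])
  also have "\<dots> \<le> (\<Sum>c\<in>{0, int h}. pyramid (chip (2 * h) q) a (int q + c)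
      + pyramid (chip (2 * h) q) a (- int q + c))"
    using h pyr by (simp add: add_increasing2)
  also have "\<dots> \<le> four_pyramids h A (int q) q"
    unfolding four_pyramids_def using a fin
    by (intro member_le_sum[of a A]) (auto intro!: sum_nonneg add_nonneg_nonneg pyr)
  finally have "1 \<le> four_pyramids h A (int q) q" .
  moreover have "0 \<le> four_pyramids h A (int q) u" for u
    unfolding four_pyramids_def by (intro sum_nonneg add_nonneg_nonneg pyr)
  ultimately have "div_effective ?G ?E"
    by (simp add: div_effective_def F_def)
  then show "\<exists>E. div_equiv ?G ((four_pyramids h A 0)(q := four_pyramids h A 0 q - 1)) E
      \<and> div_effective ?G E"
    unfolding start using div_equiv_four_pyramids[OF A(1) h] by blast
qed

text \<open>Volume does not depend on position: each jump \<open>a\<close> has four summits of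
  volume \<open>a\<^sup>2\<close>.\<close>

lemma div_degree_four_pyramids:
  assumes "0 < h"
  shows "div_degree (circulant_graph (2 * h) J) (four_pyramids h A t) = int (4 * (\<Sum>a\<in>A. a\<^sup>2))"
proof -
  let ?p = "\<lambda>a c. \<Sum>v\<in>{1..2 * h}. pyramid (chip (2 * h) v) a c"
  have "div_degree (circulant_graph (2 * h) J) (four_pyramids h A t)
      = (\<Sum>a\<in>A. \<Sum>c\<in>{0, int h}. ?p a (t + c) + ?p a (- t + c))"
    unfolding div_degree_def four_pyramids_def circulant_graph_def
    by (simp only: pre_digraph.simps sum.swap[of _ _ "{1..2 * h}"] sum.distrib)
  also have "\<dots> = (\<Sum>a\<in>A. \<Sum>c\<in>{0, int h}. (int a)\<^sup>2 + (int a)\<^sup>2)"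
    using assms by (simp only: pyramid_volume[OF sum_chip])
  also have "\<dots> = int (4 * (\<Sum>a\<in>A. a\<^sup>2))"
    using assms by (simp add: sum_distrib_left)
  finally show ?thesis .
qed

theorem theorem3p3:
  fixes n k :: nat and j :: "nat \<Rightarrow> nat" and J :: "nat set"
  assumes "even n"
    and "1 \<le> k"
    and "strict_mono_on {1..k} j"
    and "\<And>\<alpha>. \<alpha> \<in> {1..k} \<Longrightarrow> 0 < j \<alpha> \<and> j \<alpha> < n div 2"
    and "J = j ` {1..k} \<union> {n div 2}"
    and "connected (circulant_graph n J)"
  shows "gonality (circulant_graph n J) \<le> 4 * (\<Sum>\<alpha>=1..k. (j \<alpha>)\<^sup>2)"
proof -
  define h where "h = n div 2"
  define A where "A = j ` {1..k}"
  have n: "n = 2 * h" using assms(1) by (simp add: h_def)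
  have A: "A \<subseteq> {0<..<h}" "A \<noteq> {}"
    using assms(2,4) by (auto simp: A_def h_def)
  then have h: "0 < h" by auto
  have J: "J = insert h A" by (simp add: assms(5) A_def h_def)
  \<comment> \<open>Injectivity ensures that the sum over the set \<open>A\<close> merges no two
    indices.\<close>
  have "inj_on j {1..k}"
    using assms(3) by (rule strict_mono_on_imp_inj_on)
  then have sum: "(\<Sum>a\<in>A. a\<^sup>2) = (\<Sum>\<alpha>=1..k. (j \<alpha>)\<^sup>2)"
    by (simp add: A_def sum.reindex)
  show ?thesis
    unfolding gonality_def n J sum[symmetric]
    using positive_rank_four_pyramids[OF A] div_degree_four_pyramids[OF h]
    by (intro Least_le) blast
qed

end
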